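(* Let $n\ge 2$ and let $F\colon \mathbb{R}^{n\times n}\to[0,+\infty)$ be an isotropic, rank-one convex integrand which is positively $p$-homogeneous for some $p\geq n$. Then $F$ is polyconvex at every matrix $A\in \mathrm{CO}(n)$.
   Context: An integrand on $\mathbb{R}^{n\times n}$ is a Borel measurable, locally bounded function $F\colon\mathbb{R}^{n\times n}\to\mathbb{R}$. For $A\in\mathbb{R}^{n\times n}$, $M(A)\in\mathbb{R}^{\tau(n,n)}$ denotes the vector of all minors of $A$ (of all orders $1,\dots,n$), and $\tau(n,n)$ is its length. $F$ is polyconvex at $A$ if there is a convex function $G\colon\mathbb{R}^{\tau(n,n)}\to\mathbb{R}$ such that $F(A)=G(M(A))$ and $F\geq G\circ M$ on $\mathbb{R}^{n\times n}$. $F$ is rank-one convex if $t\mapsto F(A+tX)$ is convex for all $A,X\in\mathbb{R}^{n\times n}$ with $\mathrm{rank}(X)=1$. $F$ is positively $p$-homogeneous if $F(tA)=t^pF(A)$ for all $A\in\mathbb{R}^{n\times n}$ and $t>0$. $F$ is isotropic if $F(QAR)=F(A)$ for all $A\in\mathbb{R}^{n\times n}$ and all $Q,R\in \mathrm{SO}(n)$. $\mathrm{CO}(n)=\{tQ: Q\in \mathrm{O}(n),\ t\in\mathbb{R}\}$. *)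

theory Defs
  imports "HOL-Analysis.Analysis"
begin

definition integrand :: "(real^'n^'n \<Rightarrow> real) \<Rightarrow> bool" where
  "integrand F \<longleftrightarrow> F \<in> borel_measurable borel \<and>
     (\<forall>A. \<exists>U. open U \<and> A \<in> U \<and> bounded (F ` U))"

(* A minor is indexed by its nonempty sets of rows and columns, so this type has
   exactly tau(n,n) elements. *)
typedef ('n::finite) minor_index = "{(I, J) | (I :: 'n set) (J :: 'n set). I \<noteq> {} \<and> card I = card J}"
  by (rule exI[of _ "({undefined}, {undefined})"]) simp

instance minor_index :: (finite) finite
proof
  have "inj (Rep_minor_index :: 'a minor_index \<Rightarrow> _)"
    by (simp add: inj_on_def Rep_minor_index_inject)
  then show "finite (UNIV :: 'a minor_index set)"
    by (rule finite_imageD[rotated]) simp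
qed

(* The determinant of the submatrix of A with rows I and columns J, both listed in
   increasing order, written out by the Leibniz formula: the size of the submatrix
   varies with I, so the library's det, whose size is a type, does not apply.
   The linear order on the index type serves only to fix the sign of each minor. *)
definition minor :: "real^'n::{finite,linorder}^'n::_ \<Rightarrow> 'n set \<Rightarrow> 'n set \<Rightarrow> real" where
  "minor A I J = (\<Sum>\<pi> | \<pi> permutes {..<card I}. of_int (sign \<pi>) *
     (\<Prod>k<card I. A $ (sorted_list_of_set I ! k) $ (sorted_list_of_set J ! \<pi> k)))"

definition minors :: "real^'n::{finite,linorder}^'n::_ \<Rightarrow> real^('n minor_index)" where
  "minors A = (\<chi> ij. case Rep_minor_index ij of (I, J) \<Rightarrow> minor A I J)"

definition polyconvex_at ::
    "(real^'n::{finite,linorder}^'n::_ \<Rightarrow> real) \<Rightarrow> real^'n::_^'n::_ \<Rightarrow> bool" where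
  "polyconvex_at F A \<longleftrightarrow>
     (\<exists>G :: real^('n minor_index) \<Rightarrow> real. convex_on UNIV G \<and>
        F A = G (minors A) \<and> (\<forall>B. F B \<ge> G (minors B)))"

definition rank_one_convex :: "(real^'n^'n \<Rightarrow> real) \<Rightarrow> bool" where
  "rank_one_convex F \<longleftrightarrow>
     (\<forall>A X. rank X = 1 \<longrightarrow> convex_on UNIV (\<lambda>t::real. F (A + t *\<^sub>R X)))"

definition pos_homogeneous :: "real \<Rightarrow> (real^'n^'n \<Rightarrow> real) \<Rightarrow> bool" where
  "pos_homogeneous p F \<longleftrightarrow> (\<forall>A. \<forall>t>0. F (t *\<^sub>R A) = t powr p * F A)"

definition SO :: "(real^'n^'n) set" where
  "SO = {Q. orthogonal_matrix Q \<and> det Q = 1}"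

definition isotropic :: "(real^'n^'n \<Rightarrow> real) \<Rightarrow> bool" where
  "isotropic F \<longleftrightarrow> (\<forall>A. \<forall>Q\<in>SO. \<forall>R\<in>SO. F (Q ** A ** R) = F A)"

definition CO :: "(real^'n^'n) set" where
  "CO = {t *\<^sub>R Q | t Q. orthogonal_matrix Q}"

end

theory Submission
  imports Defs
begin

text \<open>
  Rank-one convexity and isotropy show that \<open>F B\<close> is at least the value of \<open>F\<close> at a conformal
  matrix of the same determinant. Let \<open>\<bar>det B\<bar> = g^n\<close>. As long as \<open>B\<close> is not \<open>g\<close> times an
  orthogonal matrix, its extreme singular values lie strictly on either side of \<open>g\<close>, so \<open>B v = g u\<close>
  for some unit vectors \<open>u\<close>, \<open>v\<close>. Put \<open>w = B\<^sup>T u - g v\<close>, which is orthogonal to \<open>v\<close>, and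
  \<open>C = B - u \<otimes> w\<close>. Reflecting along \<open>u\<close> and \<open>v\<close> exchanges \<open>C + u \<otimes> w\<close> and \<open>C - u \<otimes> w\<close>, so the
  convex function \<open>t \<mapsto> F (C + t (u \<otimes> w))\<close> takes equal values at 1 and -1, whence \<open>F C \<le> F B\<close>.
  The determinant is unchanged and the eigenspace of \<open>B\<^sup>T B\<close> for \<open>g\<^sup>2\<close> has grown. In the end, by
  homogeneity, \<open>F B \<ge> F R * (det R * det B)\<^sub>+ powr (p / n)\<close> for every orthogonal \<open>R\<close>, with equality
  on positive multiples of \<open>R\<close>, and the right-hand side is a convex function of the minor
  \<open>det B\<close> because \<open>p \<ge> n\<close>.
\<close>

section \<open>Matrix-vector products, transposes and rank-one matrices\<close>

declare transpose_matrix_vector [simp del]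

lemma inner_transpose_mult:
  fixes A :: "real^'n^'m"
  shows "x \<bullet> (A *v y) = (transpose A *v x) \<bullet> y"
  by (metis dot_lmul_matrix vector_transpose_matrix transpose_transpose)

lemma inner_gram:
  fixes A :: "real^'n^'m"
  shows "x \<bullet> (transpose A *v (A *v y)) = (A *v x) \<bullet> (A *v y)"
  by (simp add: inner_transpose_mult)

definition outer :: "real^'m \<Rightarrow> real^'n \<Rightarrow> real^'n^'m" where
  "outer u w = (\<chi> i j. u $ i * w $ j)"

lemma outer_mult_vec [simp]: "outer u w *v x = (w \<bullet> x) *\<^sub>R u"
  by (simp add: outer_def matrix_vector_mult_def inner_vec_def vec_eq_iff sum_distrib_left
      sum_distrib_right mult_ac)

lemma transpose_outer [simp]: "transpose (outer u w) = outer w u"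
  by (simp add: outer_def transpose_def vec_eq_iff mult.commute)

lemma transpose_diff: "transpose (A - B) = transpose A - transpose B"
  by (simp add: transpose_def vec_eq_iff)

lemma scaleR_mult_vec: "(c *\<^sub>R A) *v x = c *\<^sub>R (A *v (x::real^'n))"
  by (metis scaleR_matrix_vector_assoc)

lemma rank_outer:
  assumes "u \<noteq> 0" "w \<noteq> 0"
  shows "rank (outer u w) = 1"
proof -
  have "range ((*v) (outer u w)) = span {u}"
  proof -
    have "\<exists>x. c *\<^sub>R u = (w \<bullet> x) *\<^sub>R u" for c
      by (rule exI[of _ "(c / (w \<bullet> w)) *\<^sub>R w"]) (use assms in simp)
    then show ?thesis by (fastforce simp: span_singleton)
  qed
  then show ?thesis
    using assms by (simp add: rank_dim_range)
qed

section \<open>Extreme singular vectors\<close>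

text \<open>With \<open>w = T *v v\<close>, the form at \<open>v - t *\<^sub>R w\<close> has the
  linear term \<open>- 2 * t * (w \<bullet> w)\<close>, which would make it negative for small
  positive \<open>t\<close> unless \<open>w = 0\<close>.\<close>

lemma psd_kernel:
  fixes T :: "real^'n^'n"
  assumes sym: "transpose T = T" and psd: "\<And>x. x \<bullet> (T *v x) \<ge> 0" and "v \<bullet> (T *v v) = 0"
  shows "T *v v = 0"
proof (rule ccontr)
  assume nz: "T *v v \<noteq> 0"
  define w where "w = T *v v"
  define a where "a = w \<bullet> w"
  define q where "q = w \<bullet> (T *v w)"
  \<comment> \<open>The denominator \<open>q + 1\<close> is positive even for \<open>q = 0\<close>
    and still gives \<open>t * q \<le> a\<close>, so that the form is at most
    \<open>- t * a\<close>.\<close>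
  define t where "t = a / (q + 1)"
  have a: "a > 0" using nz by (simp add: a_def w_def)
  have q: "q \<ge> 0" using psd by (simp add: q_def)
  have t: "t > 0" using a q by (simp add: t_def)
  have vw: "v \<bullet> (T *v w) = a"
    using inner_transpose_mult[of v T w] by (simp add: sym a_def w_def)
  have "(v - t *\<^sub>R w) \<bullet> (T *v (v - t *\<^sub>R w)) = t * (t * q) - 2 * t * a"
    using vw assms(3)
    by (simp add: algebra_simps inner_diff_left inner_diff_right q_def)
       (simp add: w_def[symmetric] a_def)
  moreover have "t * q \<le> a"
    using a q by (simp add: t_def field_simps)
  then have "t * (t * q) \<le> t * a"
    using t by simp
  moreover have "t * a > 0" using t a by simp
  ultimately show False using psd[of "v - t *\<^sub>R w"] by linarith
qed

text \<open>The unit sphere is compact, so the stretch attains a maximum \<open>s\<close> at some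
  \<open>v\<close>. Then \<open>T\<close>, which is \<open>s^2 I - A^T A\<close>, is positive
  semidefinite with vanishing form at \<open>v\<close>, and \<open>psd_kernel\<close> yields the
  eigenvector equation.\<close>

lemma max_singular_vector:
  fixes A :: "real^'n^'n"
  obtains v where "norm v = 1" "\<And>x. norm (A *v x) \<le> norm (A *v v) * norm x"
    "transpose A *v (A *v v) = (norm (A *v v))\<^sup>2 *\<^sub>R v"
proof -
  have "\<exists>v\<in>sphere (0::real^'n) 1. \<forall>y\<in>sphere 0 1. norm (A *v y) \<le> norm (A *v v)"
    by (intro continuous_attains_sup continuous_intros) auto
  then obtain v where v: "norm v = 1" and sup: "\<And>y. norm y = 1 \<Longrightarrow> norm (A *v y) \<le> norm (A *v v)"
    by auto
  define s where "s = norm (A *v v)"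
  have le: "norm (A *v x) \<le> s * norm x" for x
  proof (cases "x = 0")
    case False
    then have "norm (A *v (x /\<^sub>R norm x)) \<le> s"
      unfolding s_def by (intro sup) simp
    with False show ?thesis
      by (simp add: matrix_vector_mult_scaleR field_simps)
  qed simp
  define T where "T = s\<^sup>2 *\<^sub>R mat 1 - transpose A ** A"
  have Tx: "T *v x = s\<^sup>2 *\<^sub>R x - transpose A *v (A *v x)" for x
    by (simp add: T_def matrix_vector_mult_diff_rdistrib scaleR_mult_vec matrix_vector_mul_assoc)
  have q: "x \<bullet> (T *v x) = s\<^sup>2 * (norm x)\<^sup>2 - (norm (A *v x))\<^sup>2" for x
    by (simp add: Tx inner_diff_right inner_gram power2_norm_eq_inner)
  have "T *v v = 0"
  proof (rule psd_kernel)
    show "transpose T = T"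
      by (simp add: T_def transpose_diff matrix_transpose_mul transpose_scalar transpose_mat)
    show "x \<bullet> (T *v x) \<ge> 0" for x
      using power_mono[OF le[of x], of 2] by (simp add: q power_mult_distrib)
    show "v \<bullet> (T *v v) = 0"
      by (simp add: q v s_def)
  qed
  then show ?thesis
    using that[of v] v le by (simp add: Tx s_def)
qed

lemma min_singular_vector:
  fixes A :: "real^'n^'n"
  obtains v where "norm v = 1" "\<And>x. norm (A *v v) * norm x \<le> norm (A *v x)"
    "transpose A *v (A *v v) = (norm (A *v v))\<^sup>2 *\<^sub>R v"
proof -
  have "\<exists>v\<in>sphere (0::real^'n) 1. \<forall>y\<in>sphere 0 1. norm (A *v v) \<le> norm (A *v y)"
    by (intro continuous_attains_inf continuous_intros) auto
  then obtain v where v: "norm v = 1" and inf: "\<And>y. norm y = 1 \<Longrightarrow> norm (A *v v) \<le> norm (A *v y)"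
    by auto
  define s where "s = norm (A *v v)"
  have le: "s * norm x \<le> norm (A *v x)" for x
  proof (cases "x = 0")
    case False
    then have "s \<le> norm (A *v (x /\<^sub>R norm x))"
      unfolding s_def by (intro inf) simp
    with False show ?thesis
      by (simp add: matrix_vector_mult_scaleR field_simps)
  qed simp
  define T where "T = transpose A ** A - s\<^sup>2 *\<^sub>R mat 1"
  have Tx: "T *v x = transpose A *v (A *v x) - s\<^sup>2 *\<^sub>R x" for x
    by (simp add: T_def matrix_vector_mult_diff_rdistrib scaleR_mult_vec matrix_vector_mul_assoc)
  have q: "x \<bullet> (T *v x) = (norm (A *v x))\<^sup>2 - s\<^sup>2 * (norm x)\<^sup>2" for x
    by (simp add: Tx inner_diff_right inner_gram power2_norm_eq_inner)
  have "T *v v = 0"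
  proof (rule psd_kernel)
    show "transpose T = T"
      by (simp add: T_def transpose_diff matrix_transpose_mul transpose_scalar transpose_mat)
    show "x \<bullet> (T *v x) \<ge> 0" for x
      using power_mono[OF le[of x], of 2] by (simp add: q power_mult_distrib s_def)
    show "v \<bullet> (T *v v) = 0"
      by (simp add: q v s_def)
  qed
  then show ?thesis
    using that[of v] v le by (simp add: Tx s_def)
qed

section \<open>Determinants of contractions and isometries\<close>

lemma det_orthogonal_square:
  fixes Q :: "real^'n^'n"
  assumes "orthogonal_matrix Q"
  shows "det Q * det Q = 1"
  using det_orthogonal_matrix[OF assms] by auto

text \<open>An orthogonal change of basis taking \<open>axis k 1\<close> to \<open>v\<close> makes
  the matrix diagonal, with one entry \<open>1 + c\<close> and all others 1.\<close>

lemma det_rank_one_update: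
  fixes v :: "real^'n"
  assumes v: "norm v = 1"
  shows "det (mat 1 + c *\<^sub>R outer v v) = 1 + c"
proof -
  fix k :: 'n
  obtain Q where Q: "orthogonal_matrix Q" "Q *v axis k 1 = v"
    using orthogonal_matrix_exists_basis[OF v] by metis
  define D :: "real^'n^'n" where "D = mat 1 + c *\<^sub>R outer (axis k 1) (axis k 1)"
  have Dx: "D *v x = x + (c * (x $ k)) *\<^sub>R axis k 1" for x
    by (simp add: D_def matrix_vector_mult_add_rdistrib scaleR_mult_vec inner_axis')
  have "(mat 1 + c *\<^sub>R outer v v) ** Q = Q ** D"
  proof -
    have "v \<bullet> (Q *v x) = x $ k" for x
    proof -
      have "v \<bullet> (Q *v x) = (transpose Q *v (Q *v axis k 1)) \<bullet> x"
        using Q by (simp add: inner_transpose_mult)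
      also have "\<dots> = axis k 1 \<bullet> x"
        using Q(1) by (simp add: matrix_vector_mul_assoc orthogonal_matrix)
      finally show ?thesis by (simp add: inner_axis' )
    qed
    then show ?thesis
      by (simp add: matrix_eq matrix_vector_mul_assoc[symmetric] matrix_vector_mult_add_rdistrib
          scaleR_mult_vec Dx matrix_vector_right_distrib matrix_vector_mult_scaleR Q(2))
  qed
  then have "det (mat 1 + c *\<^sub>R outer v v) * det Q = det Q * det D"
    by (metis det_mul)
  moreover have "det Q \<noteq> 0"
    using det_orthogonal_square[OF Q(1)] by auto
  ultimately have "det (mat 1 + c *\<^sub>R outer v v) = det D" by simp
  also have "det D = (\<Prod>i\<in>UNIV. D $ i $ i)"
    by (rule det_diagonal) (auto simp: D_def mat_def outer_def axis_def)
  also have "\<dots> = (\<Prod>i\<in>UNIV. if i = k then 1 + c else 1)"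
    by (rule prod.cong) (auto simp: D_def mat_def outer_def axis_def)
  finally show ?thesis by simp
qed

text \<open>The powers of \<open>A\<close> are contractions too, so their entries lie in [-1, 1] and
  the Leibniz formula bounds all their determinants by \<open>n!\<close>, whereas the powers of a
  number above 1 are unbounded.\<close>

lemma abs_det_contraction_le_1:
  fixes A :: "real^'n^'n"
  assumes "\<And>x. norm (A *v x) \<le> norm x"
  shows "\<bar>det A\<bar> \<le> 1"
proof (rule ccontr)
  assume "\<not> \<bar>det A\<bar> \<le> 1"
  define P where "P k = ((**) A ^^ k) (mat 1)" for k
  have contr: "norm (P k *v x) \<le> norm x" for k x
    by (induction k) (auto simp: P_def matrix_vector_mul_assoc[symmetric] intro: order_trans[OF assms])
  have detP: "det (P k) = det A ^ k" for k
    by (induction k) (auto simp: P_def det_mul)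
  have entry: "\<bar>P k $ i $ j\<bar> \<le> 1" for k i j
  proof -
    have "\<bar>P k $ i $ j\<bar> = \<bar>(P k *v axis j 1) $ i\<bar>"
      by (simp add: matrix_vector_mult_basis column_def)
    also have "\<dots> \<le> norm (P k *v axis j 1)"
      by (rule component_le_norm_cart)
    also have "\<dots> \<le> 1" using contr[of k "axis j 1"] by simp
    finally show ?thesis .
  qed
  have "\<bar>det (P k)\<bar> \<le> (\<Sum>\<pi> | \<pi> permutes (UNIV::'n set). 1)" for k
    unfolding det_def
  proof (rule order_trans[OF sum_abs] , rule sum_mono)
    fix \<pi> :: "'n \<Rightarrow> 'n"
    have "(\<Prod>i\<in>UNIV. \<bar>P k $ i $ \<pi> i\<bar>) \<le> 1"
      by (intro prod_le_1) (simp add: entry)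
    then show "\<bar>of_int (sign \<pi>) * (\<Prod>i\<in>UNIV. P k $ i $ \<pi> i)\<bar> \<le> 1"
      by (simp add: abs_mult abs_prod sign_def)
  qed
  moreover obtain k where "(\<Sum>\<pi> | \<pi> permutes (UNIV::'n set). 1) < \<bar>det A\<bar> ^ k"
    using real_arch_pow \<open>\<not> \<bar>det A\<bar> \<le> 1\<close> by (metis not_le)
  ultimately show False
    by (metis detP power_abs not_le)
qed

text \<open>Stretching a contraction along a minimal singular vector until that singular value is 1
  keeps it a contraction, so its determinant cannot have been 1 before.\<close>

lemma contraction_det_isometry:
  fixes A :: "real^'n^'n"
  assumes contr: "\<And>x. norm (A *v x) \<le> norm x" and det: "\<bar>det A\<bar> \<ge> 1"
  shows "norm (A *v x) = norm x"
proof -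
  obtain v where v: "norm v = 1" and min: "\<And>x. norm (A *v v) * norm x \<le> norm (A *v x)"
    and eig: "transpose A *v (A *v v) = (norm (A *v v))\<^sup>2 *\<^sub>R v"
    using min_singular_vector[of A] by metis
  define s where "s = norm (A *v v)"
  have "det A \<noteq> 0" using det by auto
  then have "inj ((*v) A)" by (simp add: inj_matrix_vector_mult invertible_det_nz)
  moreover have "v \<noteq> 0" using v by auto
  ultimately have "A *v v \<noteq> 0" by (metis injD matrix_vector_mult_0_right)
  then have s: "s > 0" by (simp add: s_def)
  define D where "D = mat 1 + (1 / s - 1) *\<^sub>R outer v v"
  have "norm ((A ** D) *v x) \<le> norm x" for x
  proof -
    define a where "a = v \<bullet> x"
    define w where "w = x - a *\<^sub>R v"
    have vv: "v \<bullet> v = 1" using v by (simp add: norm_eq_1)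
    have vw: "v \<bullet> w = 0" by (simp add: w_def inner_diff_right a_def vv)
    have x: "x = a *\<^sub>R v + w" by (simp add: w_def)
    \<comment> \<open>The eigenvector equation keeps the images of \<open>v\<close> and of its
      orthogonal complement orthogonal, so Pythagoras applies to \<open>A ** D\<close>.\<close>
    have AvAw: "(A *v v) \<bullet> (A *v w) = 0"
      using inner_gram[of w A v] by (simp add: eig vw inner_commute)
    have "D *v x = (a / s) *\<^sub>R v + w"
      by (simp add: D_def matrix_vector_mult_add_rdistrib scaleR_mult_vec a_def[symmetric] w_def
          algebra_simps)
    then have "(A ** D) *v x = (a / s) *\<^sub>R (A *v v) + A *v w"
      by (simp add: matrix_vector_mul_assoc[symmetric] matrix_vector_right_distrib
          matrix_vector_mult_scaleR)
    then have "(norm ((A ** D) *v x))\<^sup>2 = (norm ((a / s) *\<^sub>R (A *v v)))\<^sup>2 + (norm (A *v w))\<^sup>2"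
      using AvAw by (simp add: norm_add_Pythagorean orthogonal_def)
    also have "\<dots> = a\<^sup>2 + (norm (A *v w))\<^sup>2"
      using s by (simp add: s_def[symmetric] power_divide)
    also have "\<dots> \<le> a\<^sup>2 + (norm w)\<^sup>2"
      using contr by (simp add: power_mono)
    also have "\<dots> = (norm x)\<^sup>2"
      using x vw v by (simp add: norm_add_Pythagorean orthogonal_def)
    finally show ?thesis by (simp add: power2_le_iff_abs_le)
  qed
  then have "\<bar>det (A ** D)\<bar> \<le> 1"
    by (rule abs_det_contraction_le_1)
  \<comment> \<open>Here \<open>det D = 1 / s\<close>. Hence the smallest stretch \<open>s\<close>
    is at least 1.\<close>
  then have "\<bar>det A\<bar> \<le> s"
    using s unfolding D_def det_mul det_rank_one_update[OF v]
    by (simp add: abs_mult field_simps)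
  then have "1 * norm x \<le> s * norm x"
    using det by (intro mult_right_mono) auto
  then show ?thesis
    using min[of x] contr[of x] by (simp add: s_def)
qed

lemma det_scaleR:
  fixes A :: "real^'n^'n"
  shows "det (c *\<^sub>R A) = c ^ CARD('n) * det A"
proof -
  have "c *\<^sub>R A = matrix ((*\<^sub>R) c) ** A"
    by (simp add: matrix_eq matrix_vector_mul_assoc[symmetric] scaleR_mult_vec)
  then show ?thesis by (metis det_mul det_matrix_scaleR)
qed

lemma norm_bound_det_isometry:
  fixes B :: "real^'n^'n"
  assumes g: "g > 0" and le: "\<And>x. norm (B *v x) \<le> g * norm x" and det: "\<bar>det B\<bar> \<ge> g ^ CARD('n)"
  shows "norm (B *v x) = g * norm x"
proof -
  have "norm (((1 / g) *\<^sub>R B) *v x) = norm x"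
  proof (rule contraction_det_isometry)
    show "norm (((1 / g) *\<^sub>R B) *v x) \<le> norm x" for x
      using le[of x] g by (simp add: scaleR_mult_vec field_simps)
    show "\<bar>det ((1 / g) *\<^sub>R B)\<bar> \<ge> 1"
      using det g by (simp add: det_scaleR abs_mult power_divide field_simps)
  qed
  then show ?thesis
    using g by (simp add: scaleR_mult_vec field_simps)
qed

text \<open>The inverse of \<open>B\<close> stretches by at most \<open>1 / g\<close> and has
  determinant at least \<open>(1 / g)^n\<close> in absolute value, so the upper-bound version
  applies to it.\<close>

lemma norm_lower_bound_det_isometry:
  fixes B :: "real^'n^'n"
  assumes g: "g > 0" and ge: "\<And>x. g * norm x \<le> norm (B *v x)"
    and det: "\<bar>det B\<bar> \<le> g ^ CARD('n)" "det B \<noteq> 0"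
  shows "norm (B *v x) = g * norm x"
proof -
  obtain C where C: "C ** B = mat 1" "B ** C = mat 1"
    using det(2) by (metis invertible_det_nz invertible_def)
  have "norm (C *v (B *v x)) = (1 / g) * norm (B *v x)"
  proof (rule norm_bound_det_isometry)
    show "1 / g > 0" using g by simp
    show "norm (C *v y) \<le> (1 / g) * norm y" for y
      using ge[of "C *v y"] g C by (simp add: matrix_vector_mul_assoc field_simps)
    have "\<bar>det C\<bar> * \<bar>det B\<bar> = 1"
      using arg_cong[OF C(1), of det] by (simp add: det_mul abs_mult flip: abs_mult)
    then have "1 \<le> \<bar>det C\<bar> * g ^ CARD('n)"
      using mult_left_mono[OF det(1), of "\<bar>det C\<bar>"] by simp
    then show "\<bar>det C\<bar> \<ge> (1 / g) ^ CARD('n)"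
      using g by (simp add: power_divide field_simps)
  qed
  then show ?thesis
    using g C by (simp add: matrix_vector_mul_assoc field_simps)
qed

section \<open>Similarities and vectors stretched by the factor \<open>g\<close>\<close>

lemma gram_of_similarity:
  fixes B :: "real^'n^'n"
  assumes "\<And>x. norm (B *v x) = g * norm x"
  shows "transpose B *v (B *v x) = g\<^sup>2 *\<^sub>R x"
proof -
  define T where "T = g\<^sup>2 *\<^sub>R mat 1 - transpose B ** B"
  have Tx: "T *v x = g\<^sup>2 *\<^sub>R x - transpose B *v (B *v x)" for x
    by (simp add: T_def matrix_vector_mult_diff_rdistrib scaleR_mult_vec matrix_vector_mul_assoc)
  have q: "x \<bullet> (T *v x) = 0" for x
    by (simp add: Tx inner_diff_right inner_gram assms power_mult_distrib flip: power2_norm_eq_inner)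
  have "T *v x = 0"
    by (rule psd_kernel)
      (simp_all add: q, simp add: T_def transpose_diff matrix_transpose_mul transpose_scalar transpose_mat)
  then show ?thesis by (simp add: Tx)
qed

text \<open>It is the whole space exactly when \<open>B\<close> is \<open>g\<close> times an
  orthogonal matrix; its dimension measures the progress of the reduction.\<close>

definition similarity_space :: "real \<Rightarrow> real^'n^'n \<Rightarrow> (real^'n) set" where
  "similarity_space g B = {z. transpose B *v (B *v z) = g\<^sup>2 *\<^sub>R z}"

text \<open>If all singular values were at most \<open>g\<close>, or all at least \<open>g\<close>,
  the determinant would force them all to equal \<open>g\<close>. A combination of the extreme
  singular vectors \<open>x\<close> and \<open>y\<close> therefore has stretch \<open>g\<close>.
  Both are eigenvectors of \<open>B^T B\<close> for eigenvalues other than \<open>g^2\<close>, hence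
  orthogonal to the similarity space.\<close>

lemma exists_vector_of_stretch:
  fixes B :: "real^'n^'n"
  assumes g: "g > 0" and det: "\<bar>det B\<bar> = g ^ CARD('n)" and ne: "similarity_space g B \<noteq> UNIV"
  obtains v where "norm v = 1" "norm (B *v v) = g" "\<And>z. z \<in> similarity_space g B \<Longrightarrow> v \<bullet> z = 0"
proof -
  obtain x where x: "norm x = 1" "\<And>y. norm (B *v y) \<le> norm (B *v x) * norm y"
    and ex: "transpose B *v (B *v x) = (norm (B *v x))\<^sup>2 *\<^sub>R x"
    using max_singular_vector[of B] by metis
  obtain y where y: "norm y = 1" "\<And>z. norm (B *v y) * norm z \<le> norm (B *v z)"
    and ey: "transpose B *v (B *v y) = (norm (B *v y))\<^sup>2 *\<^sub>R y"
    using min_singular_vector[of B] by metis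
  define s where "s = norm (B *v x)"
  define r where "r = norm (B *v y)"
  have no: "\<not> (\<forall>x. norm (B *v x) = g * norm x)"
    using ne gram_of_similarity[of B g] by (auto simp: similarity_space_def)
  have s: "s > g"
  proof (rule ccontr)
    assume "\<not> s > g"
    then have "norm (B *v z) \<le> g * norm z" for z
      using x(2)[of z] mult_right_mono[of s g "norm z"] by (simp add: s_def)
    then show False using norm_bound_det_isometry[OF g, of B] det no by simp
  qed
  have r: "r < g"
  proof (rule ccontr)
    assume "\<not> r < g"
    then have "g * norm z \<le> norm (B *v z)" for z
      using y(2)[of z] mult_right_mono[of g r "norm z"] by (simp add: r_def)
    moreover have "det B \<noteq> 0" using det g by auto
    ultimately show False using norm_lower_bound_det_isometry[OF g, of B] det no by simp
  qed
  have r0: "r \<ge> 0" by (simp add: r_def)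
  have sq: "r\<^sup>2 < g\<^sup>2" "g\<^sup>2 < s\<^sup>2"
    using r s r0 g by (simp_all add: power_strict_mono)
  have eigen_orth: "z \<bullet> w = 0"
    if "transpose B *v (B *v z) = a *\<^sub>R z" "transpose B *v (B *v w) = b *\<^sub>R w" "a \<noteq> b" for z w a b
  proof -
    have "b * (z \<bullet> w) = a * (z \<bullet> w)"
      using inner_gram[of z B w] inner_gram[of w B z] that(1,2) by (simp add: inner_commute)
    then show ?thesis using that(3) by simp
  qed
  have xy: "x \<bullet> y = 0"
    by (rule eigen_orth[OF ex ey]) (use sq in \<open>simp flip: s_def r_def\<close>)
  have xx: "x \<bullet> x = 1" "y \<bullet> y = 1" using x y by (simp_all add: norm_eq_1)
  \<comment> \<open>The weight that mixes \<open>s^2\<close> and \<open>r^2\<close> to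
    \<open>g^2\<close>. As \<open>x\<close>, \<open>y\<close> are orthonormal with orthogonal
    images, coefficients \<open>sqrt t\<close> and \<open>sqrt (1 - t)\<close> mix squared norms
    with weights \<open>t\<close> and \<open>1 - t\<close>.\<close>
  define t where "t = (g\<^sup>2 - r\<^sup>2) / (s\<^sup>2 - r\<^sup>2)"
  have t: "0 \<le> t" "t \<le> 1" "t * s\<^sup>2 + (1 - t) * r\<^sup>2 = g\<^sup>2"
  proof -
    show "0 \<le> t" "t \<le> 1" using sq by (simp_all add: t_def)
    have "t * (s\<^sup>2 - r\<^sup>2) = g\<^sup>2 - r\<^sup>2" using sq by (simp add: t_def)
    then show "t * s\<^sup>2 + (1 - t) * r\<^sup>2 = g\<^sup>2" by (simp add: algebra_simps)
  qed
  define v where "v = sqrt t *\<^sub>R x + sqrt (1 - t) *\<^sub>R y"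
  have "(norm v)\<^sup>2 = t * (x \<bullet> x) + (1 - t) * (y \<bullet> y)"
    using t xy unfolding v_def power2_norm_eq_inner
    by (simp add: inner_add_left inner_add_right inner_commute[of y x] flip: mult.assoc)
  then have nv: "norm v = 1" by (simp add: xx abs_square_eq_1)
  have BxBy: "(B *v x) \<bullet> (B *v y) = 0"
    using inner_gram[of x B y] by (simp add: ey xy)
  have "(norm (B *v v))\<^sup>2 = t * s\<^sup>2 + (1 - t) * r\<^sup>2"
    using t BxBy unfolding v_def s_def r_def power2_norm_eq_inner
    by (simp add: inner_add_left inner_add_right inner_commute[of "B *v y" "B *v x"]
        matrix_vector_right_distrib matrix_vector_mult_scaleR flip: mult.assoc)
  then have nBv: "norm (B *v v) = g"
    using t g by (simp add: power2_eq_iff_nonneg)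
  have "v \<bullet> z = 0" if "z \<in> similarity_space g B" for z
  proof -
    have ez: "transpose B *v (B *v z) = g\<^sup>2 *\<^sub>R z" using that by (simp add: similarity_space_def)
    have "x \<bullet> z = 0" "y \<bullet> z = 0"
      by (rule eigen_orth[OF ex ez], use sq in \<open>simp flip: s_def\<close>)
         (rule eigen_orth[OF ey ez], use sq in \<open>simp flip: r_def\<close>)
    then show ?thesis by (simp add: v_def inner_add_left)
  qed
  with nv nBv show ?thesis by (rule that)
qed

section \<open>Reflections and isotropy\<close>

text \<open>For a unit vector \<open>v\<close>, the Householder reflection in the hyperplane
  orthogonal to \<open>v\<close>, in the form that \<open>det_rank_one_update\<close>
  accepts.\<close>

definition reflection :: "real^'n \<Rightarrow> real^'n^'n" where
  "reflection v = mat 1 + (- 2) *\<^sub>R outer v v"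

lemma reflection_mult_vec [simp]: "reflection v *v x = x - (2 * (v \<bullet> x)) *\<^sub>R v"
  by (simp add: reflection_def matrix_vector_mult_diff_rdistrib scaleR_mult_vec)

lemma det_reflection: "norm v = 1 \<Longrightarrow> det (reflection v) = -1"
  unfolding reflection_def by (subst det_rank_one_update) simp_all

lemma reflection_involution: "norm v = 1 \<Longrightarrow> reflection v ** reflection v = mat 1"
  by (simp add: matrix_eq matrix_vector_mul_assoc[symmetric] inner_diff_right norm_eq_1)

lemma orthogonal_reflection: "norm v = 1 \<Longrightarrow> orthogonal_matrix (reflection v)"
proof -
  have "transpose (reflection v) = reflection v"
    by (simp add: reflection_def transpose_diff transpose_scalar)
  then show "norm v = 1 \<Longrightarrow> orthogonal_matrix (reflection v)"
    by (simp add: orthogonal_matrix reflection_involution)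
qed

lemma reflection_mult_SO: "norm u = 1 \<Longrightarrow> norm v = 1 \<Longrightarrow> reflection u ** reflection v \<in> SO"
  by (simp add: SO_def orthogonal_matrix_mul orthogonal_reflection det_mul det_reflection)

text \<open>A single reflection is not in SO(n). A maximal pair of singular vectors of \<open>A\<close>, however,
  gives reflections with \<open>reflection y ** A ** reflection x = A\<close>, and products of two
  reflections are in SO(n).\<close>

lemma isotropic_reflection:
  fixes F :: "real^'n^'n \<Rightarrow> real"
  assumes iso: "isotropic F" and u: "norm u = 1" and v: "norm v = 1"
  shows "F (reflection u ** A ** reflection v) = F A"
proof (cases "A = 0")
  case True
  then show ?thesis by simp
next
  case False
  obtain x where x: "norm x = 1" "\<And>y. norm (A *v y) \<le> norm (A *v x) * norm y"
    and ex: "transpose A *v (A *v x) = (norm (A *v x))\<^sup>2 *\<^sub>R x"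
    using max_singular_vector[of A] by metis
  define s where "s = norm (A *v x)"
  have "s \<noteq> 0"
  proof
    assume "s = 0"
    then have "A *v y = 0" for y using x(2)[of y] by (simp add: s_def)
    then show False using False by (simp add: matrix_eq)
  qed
  then have s: "s > 0" by (simp add: s_def)
  define y where "y = (1 / s) *\<^sub>R (A *v x)"
  have y: "norm y = 1" using s by (simp add: y_def s_def)
  have Ax: "A *v x = s *\<^sub>R y" using s by (simp add: y_def)
  \<comment> \<open>That is, \<open>A^T y = s x\<close>. Together with \<open>A x = s y\<close> this
    makes the two reflections cancel.\<close>
  have yA: "y \<bullet> (A *v z) = s * (x \<bullet> z)" for z
    using s inner_gram[of z A x]
    by (simp add: y_def ex inner_commute flip: s_def) (simp add: power2_eq_square field_simps)
  have xx: "x \<bullet> x = 1" "y \<bullet> y = 1" using x(1) y by (simp_all add: norm_eq_1)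
  have fix_A: "reflection y ** A ** reflection x = A"
    by (simp add: matrix_eq matrix_vector_mul_assoc[symmetric] matrix_vector_mult_diff_distrib
        matrix_vector_mult_scaleR yA inner_diff_right Ax xx)
       (simp add: vec_eq_iff algebra_simps)
  have "reflection u ** A ** reflection v =
      (reflection u ** reflection y) ** A ** (reflection x ** reflection v)"
    by (subst fix_A[symmetric]) (simp add: matrix_mul_assoc)
  then show ?thesis
    using iso reflection_mult_SO[OF u y] reflection_mult_SO[OF x(1) v] by (simp add: isotropic_def)
qed

section \<open>Shears and the symmetrization step\<close>

lemma det_shear:
  fixes v w :: "real^'n"
  assumes v: "norm v = 1" and vw: "v \<bullet> w = 0"
  shows "det (mat 1 + outer v w) = 1"
proof -
  \<comment> \<open>Half of the shear. Conjugation by the reflection along \<open>v\<close> inverts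
    it, so \<open>det S\<close> squares to 1, and the whole shear is \<open>S ** S\<close>.\<close>
  define S where "S = mat 1 + (1/2) *\<^sub>R outer v w"
  have Sx: "S *v x = x + ((w \<bullet> x) / 2) *\<^sub>R v" for x
    by (simp add: S_def matrix_vector_mult_add_rdistrib scaleR_mult_vec)
  have wv: "w \<bullet> v = 0" using vw by (simp add: inner_commute)
  have vv: "v \<bullet> v = 1" using v by (simp add: norm_eq_1)
  have "S ** reflection v ** S ** reflection v = mat 1"
    by (simp add: matrix_eq matrix_vector_mul_assoc[symmetric] Sx inner_diff_right inner_add_right
        wv vv vw) (simp add: vec_eq_iff field_simps)
  then have "det (S ** reflection v ** S ** reflection v) = 1" by simp
  then have "det S * det S = 1"
    using det_reflection[OF v] by (simp add: det_mul)
  moreover have "mat 1 + outer v w = S ** S"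
    by (simp add: matrix_eq matrix_vector_mul_assoc[symmetric] Sx matrix_vector_mult_add_rdistrib
        inner_add_right wv algebra_simps flip: scaleR_add_left)
  ultimately show ?thesis by (simp add: det_mul)
qed

lemma subspace_similarity_space: "subspace (similarity_space g B)"
  by (auto simp: subspace_def similarity_space_def matrix_vector_right_distrib
      matrix_vector_mult_scaleR scaleR_add_right)

lemma similarity_space_grow:
  fixes F :: "real^'n^'n \<Rightarrow> real"
  assumes iso: "isotropic F" and roc: "rank_one_convex F"
    and g: "g > 0" and det: "\<bar>det B\<bar> = g ^ CARD('n)" and ne: "similarity_space g B \<noteq> UNIV"
  obtains C where "F C \<le> F B" "det C = det B"
    "dim (similarity_space g B) < dim (similarity_space g C)"
proof -
  obtain v where v: "norm v = 1" and nBv: "norm (B *v v) = g"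
    and orth: "\<And>z. z \<in> similarity_space g B \<Longrightarrow> v \<bullet> z = 0"
    using exists_vector_of_stretch[OF g det ne] by metis
  define u where "u = (1 / g) *\<^sub>R (B *v v)"
  have Bv: "B *v v = g *\<^sub>R u" using g by (simp add: u_def)
  have u: "norm u = 1" using g nBv by (simp add: u_def)
  have vv: "v \<bullet> v = 1" and uu: "u \<bullet> u = 1" using u v by (simp_all add: norm_eq_1)
  define w where "w = transpose B *v u - g *\<^sub>R v"
  have wx: "w \<bullet> x = u \<bullet> (B *v x) - g * (v \<bullet> x)" for x
    by (simp add: w_def inner_diff_left inner_transpose_mult)
  have wv: "w \<bullet> v = 0" by (simp add: wx Bv uu vv)
  define C where "C = B - outer u w"
  have Cx: "C *v x = B *v x - (w \<bullet> x) *\<^sub>R u" for x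
    by (simp add: C_def matrix_vector_mult_diff_rdistrib)
  have Ctx: "transpose C *v x = transpose B *v x - (u \<bullet> x) *\<^sub>R w" for x
    by (simp add: C_def transpose_diff matrix_vector_mult_diff_rdistrib)
  have FC: "F C \<le> F B"
  proof (cases "w = 0")
    case True
    then have "C = B" by (simp add: matrix_eq Cx)
    then show ?thesis by simp
  next
    case False
    have "u \<noteq> 0" using u by auto
    then have "convex_on UNIV (\<lambda>t::real. F (C + t *\<^sub>R outer u w))"
      using roc False by (simp add: rank_one_convex_def rank_outer)
    from convex_onD[OF this, of "1/2" 1 "-1"]
    have mid: "F C \<le> (1/2) * F (C + outer u w) + (1/2) * F (C - outer u w)"
      by simp
    have "reflection u ** B ** reflection v = C - outer u w"
      by (simp add: matrix_eq matrix_vector_mul_assoc[symmetric] matrix_vector_mult_diff_rdistrib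
          matrix_vector_mult_diff_distrib matrix_vector_mult_scaleR inner_diff_right Bv Cx wx uu)
        (simp add: vec_eq_iff algebra_simps)
    then have "F (C - outer u w) = F B"
      using isotropic_reflection[OF iso u v, of B] by simp
    moreover have "C + outer u w = B" by (simp add: C_def)
    ultimately show ?thesis using mid by simp
  qed
  \<comment> \<open>Since \<open>C v = g u\<close>, a shear along \<open>v\<close> on the right
    restores the removed term.\<close>
  have "B = C ** (mat 1 + outer v ((1 / g) *\<^sub>R w))"
    using g by (simp add: matrix_eq matrix_vector_mul_assoc[symmetric] Cx
        matrix_vector_mult_add_rdistrib matrix_vector_right_distrib matrix_vector_mult_scaleR
        Bv inner_add_right wv)
  moreover have "det (mat 1 + outer v ((1 / g) *\<^sub>R w)) = 1"
    using v wv by (intro det_shear) (simp_all add: inner_commute)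
  ultimately have detC: "det C = det B" by (metis det_mul mult.right_neutral)
  have "similarity_space g B \<subseteq> similarity_space g C"
  proof
    fix z assume z: "z \<in> similarity_space g B"
    then have "transpose B *v (B *v z) = g\<^sup>2 *\<^sub>R z" by (simp add: similarity_space_def)
    \<comment> \<open>\<open>g u \<bullet> B z = B v \<bullet> B z = g^2 (v \<bullet> z) =
      0\<close>.\<close>
    moreover have "u \<bullet> (B *v z) = 0"
      using inner_gram[of v B z] z orth[OF z]
      by (simp add: u_def similarity_space_def)
    moreover from this have "w \<bullet> z = 0" by (simp add: wx orth[OF z])
    ultimately show "z \<in> similarity_space g C"
      by (simp add: similarity_space_def Cx Ctx)
  qed
  \<comment> \<open>By the choice of \<open>w\<close>, both \<open>C v = g u\<close> and
    \<open>C^T u = g v\<close>.\<close>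
  moreover have "v \<in> similarity_space g C"
    by (simp add: similarity_space_def Cx Ctx wv Bv matrix_vector_mult_scaleR uu)
      (simp add: w_def algebra_simps power2_eq_square)
  moreover have "v \<notin> similarity_space g B"
    using orth[of v] vv by auto
  ultimately have "similarity_space g B \<subset> similarity_space g C" by auto
  then have "dim (similarity_space g B) < dim (similarity_space g C)"
    by (intro dim_psubset) (metis subspace_similarity_space span_eq_iff)
  with FC detC show ?thesis by (rule that)
qed

section \<open>Reduction to conformal matrices\<close>

lemma exists_conformal_minorant:
  fixes F :: "real^'n^'n \<Rightarrow> real"
  assumes iso: "isotropic F" and roc: "rank_one_convex F"
    and g: "g > 0" and det: "\<bar>det B\<bar> = g ^ CARD('n)"
  obtains Q where "orthogonal_matrix Q" "F (g *\<^sub>R Q) \<le> F B" "det (g *\<^sub>R Q) = det B"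
proof -
  have "\<exists>C. F C \<le> F B \<and> det C = det B \<and> similarity_space g C = UNIV"
    using det
  \<comment> \<open>Every reduction step lowers the codimension of the similarity space, and a step
    is possible until that space is everything.\<close>
  proof (induction "CARD('n) - dim (similarity_space g B)" arbitrary: B rule: less_induct)
    case less
    show ?case
    proof (cases "similarity_space g B = UNIV")
      case False
      obtain C where C: "F C \<le> F B" "det C = det B"
        "dim (similarity_space g B) < dim (similarity_space g C)"
        using similarity_space_grow[OF iso roc g less.prems False] by metis
      have "dim (similarity_space g C) \<le> CARD('n)"
        using dim_subset_UNIV[of "similarity_space g C"] by simp
      then have "CARD('n) - dim (similarity_space g C) < CARD('n) - dim (similarity_space g B)"
        using C(3) by (intro diff_less_mono2) auto
      moreover have "\<bar>det C\<bar> = g ^ CARD('n)" using C(2) less.prems by simp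
      ultimately obtain D where "F D \<le> F C" "det D = det C" "similarity_space g D = UNIV"
        using less.hyps[of C] by blast
      with C(1,2) show ?thesis by (metis order_trans)
    qed auto
  qed
  then obtain C where C: "F C \<le> F B" "det C = det B"
    and sim: "\<And>x. transpose C *v (C *v x) = g\<^sup>2 *\<^sub>R x"
    by (auto simp: similarity_space_def)
  define Q where "Q = (1 / g) *\<^sub>R C"
  have gQ: "g *\<^sub>R Q = C" using g by (simp add: Q_def)
  have "orthogonal_matrix Q"
    using g by (simp add: orthogonal_matrix matrix_eq matrix_vector_mul_assoc[symmetric] Q_def
        transpose_scalar scaleR_mult_vec matrix_vector_mult_scaleR sim power2_eq_square)
  then show ?thesis using that C gQ by metis
qed

text \<open>The rotation \<open>Q ** transpose R\<close> carries \<open>R\<close> to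
  \<open>Q\<close>.\<close>

lemma isotropic_orthogonal_eq:
  assumes iso: "isotropic F" and Q: "orthogonal_matrix Q" "orthogonal_matrix R" "det Q = det R"
  shows "F Q = F (R :: real^'n^'n)"
proof -
  have "Q ** transpose R \<in> SO"
    using Q det_orthogonal_square[OF Q(2)]
    by (simp add: SO_def orthogonal_matrix_mul det_mul)
  moreover have "mat 1 \<in> SO" by (simp add: SO_def orthogonal_matrix_id)
  moreover have "Q ** transpose R ** R ** mat 1 = Q"
    using Q(2) by (simp add: orthogonal_matrix flip: matrix_mul_assoc)
  ultimately show ?thesis using iso unfolding isotropic_def by metis
qed

text \<open>For \<open>det R * det B \<le> 0\<close> the bound is 0, because
  \<open>0 powr x = 0\<close>. Otherwise the conformal minorant of \<open>B\<close> is a positive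
  multiple of an orthogonal matrix with the determinant of \<open>R\<close>, and homogeneity
  evaluates \<open>F\<close> there.\<close>

lemma det_power_minorant:
  fixes F :: "real^'n^'n \<Rightarrow> real"
  assumes nonneg: "\<And>A. F A \<ge> 0" and iso: "isotropic F" and roc: "rank_one_convex F"
    and hom: "pos_homogeneous p F" and R: "orthogonal_matrix R"
  shows "F B \<ge> F R * max 0 (det R * det B) powr (p / CARD('n))"
proof (cases "det R * det B > 0")
  case True
  define n where "n = CARD('n)"
  have n: "n > 0" by (simp add: n_def)
  define d where "d = det R * det B"
  have d: "d > 0" using True by (simp add: d_def)
  define g where "g = d powr (1 / n)"
  have g: "g > 0" using d by (simp add: g_def)
  have gn: "g ^ n = d"
    using d n by (simp add: g_def powr_powr flip: powr_realpow)
  have "\<bar>det R\<bar> = 1" using det_orthogonal_matrix[OF R] by auto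
  then have "\<bar>det B\<bar> = \<bar>d\<bar>" by (simp add: d_def abs_mult)
  then have "\<bar>det B\<bar> = g ^ CARD('n)"
    using d gn by (simp add: n_def)
  then obtain Q where Q: "orthogonal_matrix Q" "F (g *\<^sub>R Q) \<le> F B" "det (g *\<^sub>R Q) = det B"
    using exists_conformal_minorant[OF iso roc g] by metis
  have "g ^ n * (det R * det Q) = g ^ n * 1"
    using Q(3) gn by (simp add: det_scaleR d_def n_def flip: Q(3)) 
  then have "det R * det Q = 1" using g by simp
  then have "det Q = det R"
    using det_orthogonal_matrix[OF R] by auto
  then have "F Q = F R" using isotropic_orthogonal_eq[OF iso Q(1) R] by simp
  moreover have "F (g *\<^sub>R Q) = g powr p * F Q"
    using hom g by (simp add: pos_homogeneous_def)
  moreover have "g powr p = d powr (p / n)"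
    by (simp add: g_def powr_powr)
  ultimately show ?thesis
    using Q(2) d by (simp add: d_def n_def mult.commute)
qed (simp add: nonneg)

section \<open>Convexity of the truncated power\<close>

lemma convex_on_max_0_powr:
  fixes q :: real
  assumes "q \<ge> 1"
  shows "convex_on UNIV (\<lambda>x. max 0 x powr q)"
proof (rule convex_on_linorderI)
  fix t x y :: real
  assume t: "0 < t" "t < 1" and xy: "x < y"
  show "max 0 ((1 - t) *\<^sub>R x + t *\<^sub>R y) powr q \<le> (1 - t) * max 0 x powr q + t * max 0 y powr q"
  proof (cases "x > 0")
    case True
    then have "(1 - t) * x + t * y > 0" using t xy by (simp add: add_pos_pos)
    then show ?thesis
      using convex_onD[OF powr_convex[OF assms], of t x y] t xy True by simp
  next
    case False
    \<comment> \<open>The left endpoint contributes nothing, so it remains to compare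
      \<open>t powr q\<close> with \<open>t\<close>, where \<open>0 < t < 1\<close> and
      \<open>q \<ge> 1\<close>.\<close>
    have "(1 - t) * x \<le> 0" "t * y \<le> t * max 0 y"
      using False t by (auto intro: mult_nonneg_nonpos mult_left_mono)
    moreover have "0 \<le> t * max 0 y" using t by simp
    ultimately have "max 0 ((1 - t) *\<^sub>R x + t *\<^sub>R y) \<le> t * max 0 y"
      unfolding real_scaleR_def by linarith
    then have "max 0 ((1 - t) *\<^sub>R x + t *\<^sub>R y) powr q \<le> (t * max 0 y) powr q"
      using assms by (intro powr_mono2) auto
    also have "\<dots> = t powr q * max 0 y powr q"
      using t by (simp add: powr_mult)
    also have "\<dots> \<le> t * max 0 y powr q"
      using powr_mono'[of 1 q t] t assms by (intro mult_right_mono) auto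
    finally show ?thesis using False by simp
  qed
qed simp

section \<open>The determinant as a minor\<close>

text \<open>Rows and columns are listed by the same enumeration \<open>f\<close>, so transporting
  permutations along \<open>f\<close> matches the two Leibniz sums term by term, with equal
  signs.\<close>

lemma minor_UNIV:
  fixes B :: "real^'n::{finite,linorder}^'n::_"
  shows "minor B UNIV UNIV = det B"
proof -
  define n where "n = CARD('n)"
  define l where "l = sorted_list_of_set (UNIV :: 'n set)"
  define f where "f k = l ! k" for k
  have f: "bij_betw f {..<n} UNIV"
    unfolding f_def by (rule bij_betw_nth) (simp_all add: l_def n_def)
  define g where "g = inv_into {..<n} f"
  have g: "bij_betw g UNIV {..<n}"
    unfolding g_def by (rule bij_betw_inv_into[OF f])
  have gf: "g (f k) = k" if "k < n" for k
    using that f by (simp add: g_def bij_betw_def)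
  have fg: "f (g i) = i" for i
    using f by (simp add: g_def bij_betw_def f_inv_into_f)
  let ?m = "map_permutation {..<n} f"
  have "minor B UNIV UNIV = (\<Sum>\<pi> | \<pi> permutes {..<n}. of_int (sign \<pi>) *
     (\<Prod>k<n. B $ f k $ f (\<pi> k)))"
    by (simp add: minor_def n_def f_def l_def)
  also have "\<dots> = (\<Sum>\<pi> | \<pi> permutes (UNIV :: 'n set). of_int (sign \<pi>) *
     (\<Prod>i\<in>UNIV. B $ i $ \<pi> i))"
  proof (rule sum.reindex_bij_witness[where i = "map_permutation UNIV g" and j = ?m])
    fix \<pi> assume "\<pi> \<in> {\<pi>. \<pi> permutes {..<n}}"
    then have p: "\<pi> permutes {..<n}" by simp
    show "map_permutation UNIV g (?m \<pi>) = \<pi>"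
      by (rule map_permutation_compose_inv[OF f p]) (simp add: gf)
    show "?m \<pi> \<in> {\<pi>. \<pi> permutes UNIV}"
      using map_permutation_permutes[OF f p] by simp
    have "sign (?m \<pi>) = sign \<pi>"
      using f p by (intro sign_map_permutation) (auto simp: bij_betw_def)
    moreover have "(\<Prod>i\<in>UNIV. B $ i $ ?m \<pi> i) = (\<Prod>k<n. B $ f k $ ?m \<pi> (f k))"
      by (rule prod.reindex_bij_betw[OF f, symmetric])
    moreover have "\<dots> = (\<Prod>k<n. B $ f k $ f (\<pi> k))"
      using f p by (intro prod.cong refl) (simp add: map_permutation_apply bij_betw_def)
    ultimately show "of_int (sign (?m \<pi>)) * (\<Prod>i\<in>UNIV. B $ i $ ?m \<pi> i) =
        of_int (sign \<pi>) * (\<Prod>k<n. B $ f k $ f (\<pi> k))" by simp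
  next
    fix \<pi> :: "'n \<Rightarrow> 'n" assume "\<pi> \<in> {\<pi>. \<pi> permutes UNIV}"
    then have p: "\<pi> permutes UNIV" by simp
    show "?m (map_permutation UNIV g \<pi>) = \<pi>"
      by (rule map_permutation_compose_inv[OF g p]) (simp add: fg)
    show "map_permutation UNIV g \<pi> \<in> {\<pi>. \<pi> permutes {..<n}}"
      using map_permutation_permutes[OF g p] by simp
  qed
  also have "\<dots> = det B" by (simp add: det_def)
  finally show ?thesis .
qed

lemma minors_det:
  obtains i where "\<And>B :: real^'n::{finite,linorder}^'n::_. minors B $ i = det B"
proof
  fix B :: "real^'n::{finite,linorder}^'n::_"
  show "minors B $ Abs_minor_index (UNIV, UNIV) = det B"
    by (simp add: minors_def Abs_minor_index_inverse minor_UNIV)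
qed

section \<open>Polyconvexity at conformal matrices\<close>

theorem theorem1p3:
  fixes F :: "real^'n::{finite,linorder}^'n::_ \<Rightarrow> real" and p :: real
  assumes "CARD('n) \<ge> 2"
    and "integrand F"
    and "\<And>A. F A \<ge> 0"
    and "isotropic F"
    and "rank_one_convex F"
    and "p \<ge> real CARD('n)"
    and "pos_homogeneous p F"
  shows "\<forall>A\<in>CO. polyconvex_at F A"
proof
  fix A :: "real^'n::_^'n::_" assume "A \<in> CO"
  then obtain t Q where A: "A = t *\<^sub>R Q" and Q: "orthogonal_matrix Q"
    by (auto simp: CO_def)
  have p: "p > 0" using assms(1,6) by simp
  show "polyconvex_at F A"
  proof (cases "t = 0")
    case True
    \<comment> \<open>Homogeneity forces \<open>F 0 = 0\<close>, so the zero function serves as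
      \<open>G\<close>.\<close>
    have "F 0 = 2 powr p * F 0"
      using assms(7) unfolding pos_homogeneous_def by (metis scaleR_zero_right zero_less_numeral)
    moreover have "2 powr p \<noteq> 1" using p by simp
    ultimately have "F A = 0" using True A by simp
    then show ?thesis
      unfolding polyconvex_at_def using assms(3)
      by (intro exI[of _ "\<lambda>_. 0"]) (simp add: convex_on_const)
  next
    case False
    \<comment> \<open>Homogeneity covers only positive factors, so the sign of \<open>t\<close> is
      moved into the orthogonal matrix.\<close>
    define R where "R = sgn t *\<^sub>R Q"
    have A': "A = \<bar>t\<bar> *\<^sub>R R" by (simp add: A R_def mult_sgn_abs abs_mult_sgn)
    have "sgn t * sgn t = 1" using False by (simp add: sgn_if)
    then have R: "orthogonal_matrix R"
      using Q by (simp add: R_def orthogonal_matrix matrix_eq matrix_vector_mul_assoc[symmetric]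
          transpose_scalar scaleR_mult_vec matrix_vector_mult_scaleR)
    obtain i where i: "\<And>B :: real^'n::_^'n::_. minors B $ i = det B"
      using minors_det by blast
    define q where "q = p / CARD('n)"
    have q: "q \<ge> 1" using assms(6) by (simp add: q_def)
    \<comment> \<open>Only the full minor enters, linearly inside a convex function. The factor
      \<open>det R\<close> is 1 or -1 and makes the argument positive at \<open>A\<close>.\<close>
    define G :: "real^('n minor_index) \<Rightarrow> real" where
      "G m = F R * max 0 (det R * m $ i) powr q" for m
    have "convex_on UNIV (\<lambda>m::real^('n minor_index). max 0 (det R * m $ i) powr q)"
    proof (rule convex_onI)
      fix s :: real and x y :: "real^('n minor_index)"
      assume "0 < s" "s < 1"
      then show "max 0 (det R * ((1 - s) *\<^sub>R x + s *\<^sub>R y) $ i) powr q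
          \<le> (1 - s) * max 0 (det R * x $ i) powr q + s * max 0 (det R * y $ i) powr q"
        using convex_onD[OF convex_on_max_0_powr[OF q], of s "det R * x $ i" "det R * y $ i"]
        by (simp add: distrib_left mult.left_commute)
    qed simp
    then have "convex_on UNIV G"
      unfolding G_def by (intro convex_on_cmul assms(3))
    moreover have "F A = G (minors A)"
    proof -
      have "det R * det A = \<bar>t\<bar> ^ CARD('n)"
        using det_orthogonal_square[OF R] by (simp add: A' det_scaleR)
      then have "max 0 (det R * det A) powr q = \<bar>t\<bar> powr p"
        using False by (simp add: q_def powr_powr flip: powr_realpow)
      moreover have "F A = \<bar>t\<bar> powr p * F R"
        using assms(7) False by (simp add: A' pos_homogeneous_def)
      ultimately show ?thesis by (simp add: G_def i)
    qed
    moreover have "F B \<ge> G (minors B)" for B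
      using det_power_minorant[OF assms(3,4,5,7) R] by (simp add: G_def i q_def)
    ultimately show ?thesis unfolding polyconvex_at_def by blast
  qed
qed

end
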